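(* Let $K\ge 1$ be an integer, let $w_i\in\mathbb{R}^d$, let $B_0,\dots,B_{K-1},B_K$ be minibatches, and for each $k\in\{0,\dots,K\}$ let $\varphi\mapsto L(\varphi,B_k)$ be a real-valued loss on $\mathbb{R}^d$ that is three times differentiable at $w_i$. For learning rates $\lambda_{\mathrm{in}},\lambda_{o}>0$ define $\varphi_0=w_i$, $$\varphi_{k+1}=\varphi_k-\lambda_{\mathrm{in}}\nabla_{\varphi_k}L(\varphi_k,B_k),\qquad k=0,\dots,K-1,$$ and the outer update $$w_{i+1}=w_i-\lambda_o\nabla_{w_i}L(\varphi_K,B_K).$$ Let $g_K=\nabla_{\varphi_0}L(\varphi_0,B_K)$ and $\Delta L_{i+1}=L(w_{i+1},B_K)-L(w_i,B_K)$. Then the first-order approximation of $\Delta L_{i+1}$ is $$\Delta L_{i+1}\approx-\lambda_o\,\|g_K\|^2\le 0,$$ that is, $\Delta L_{i+1}=-\lambda_o\|g_K\|^2+O(\lambda_{\mathrm{in}}\lambda_o)+O(\lambda_o^2)$ as $(\lambda_{\mathrm{in}},\lambda_o)\to(0,0)$, with $w_i$, $K$ and the minibatches fixed, and the leading term $-\lambda_o\|g_K\|^2$ is nonpositive.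
   Context: Setting: local meta-optimization (standard federated meta-learning, i.e. without a privacy regularizer) at one outer step $i$. $w_i$ is the local meta-learner's parameter vector. The neural field parameters $\varphi$ are initialized at $\varphi_0=w_i$ and updated by $K$ gradient steps (inner loop, learning rate $\lambda_{\mathrm{in}}$) on minibatches $B_0,\dots,B_{K-1}$ sampled from the support set; $B_K$ is a minibatch of the query set, and $\lambda_o$ is the outer-loop learning rate. $L(\varphi,B)$ denotes the loss of parameter $\varphi$ on the minibatch $B$. The gradient $\nabla_{w_i}L(\varphi_K,B_K)$ is taken through the whole inner loop, with $\varphi_K$ regarded as a function of $w_i$. $\|\cdot\|$ is the Euclidean norm. The symbol $\approx$ means equality up to terms of second order in the learning rates $(\lambda_{\mathrm{in}},\lambda_o)$. *)

theory Defs
  imports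
    "HOL-Analysis.Analysis"
    "HOL-Library.Landau_Symbols"
begin

definition gradient :: "('a::real_inner \<Rightarrow> real) \<Rightarrow> 'a \<Rightarrow> 'a" where
  "gradient f x = (THE D. GDERIV f x :> D)"

lemma gradient_eqI:
  assumes "GDERIV f x :> D"
  shows "gradient f x = D"
proof -
  have "D' = D" if "GDERIV f x :> D'" for D'
  proof -
    have "(\<lambda>h. h \<bullet> D') = (\<lambda>h. h \<bullet> D)"
      using that assms unfolding gderiv_def by (rule has_derivative_unique)
    then have "(D' - D) \<bullet> D' = (D' - D) \<bullet> D"
      by (rule fun_cong)
    then have "(D' - D) \<bullet> (D' - D) = 0"
      by (simp add: inner_diff_right)
    then show ?thesis
      by simp
  qed
  then show ?thesis
    unfolding gradient_def by (rule the_equality[of "gderiv f x", OF assms])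
qed

(* Pointwise Frechet notion: the first two derivatives exist near x, the third only at x. *)
definition three_times_differentiable_at ::
    "('a::real_normed_vector \<Rightarrow> 'b::real_normed_vector) \<Rightarrow> 'a \<Rightarrow> bool" where
  "three_times_differentiable_at f x \<longleftrightarrow>
    (\<exists>(D1 :: 'a \<Rightarrow> 'a \<Rightarrow>\<^sub>L 'b) (D2 :: 'a \<Rightarrow> 'a \<Rightarrow>\<^sub>L 'a \<Rightarrow>\<^sub>L 'b)
      (D3 :: 'a \<Rightarrow>\<^sub>L 'a \<Rightarrow>\<^sub>L 'a \<Rightarrow>\<^sub>L 'b).
      (\<forall>\<^sub>F y in nhds x. (f has_derivative blinfun_apply (D1 y)) (at y)) \<and>
      (\<forall>\<^sub>F y in nhds x. (D1 has_derivative blinfun_apply (D2 y)) (at y)) \<and>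
      (D2 has_derivative blinfun_apply D3) (at x))"

primrec inner_loop ::
    "('a::real_inner \<Rightarrow> 'b \<Rightarrow> real) \<Rightarrow> (nat \<Rightarrow> 'b) \<Rightarrow> real \<Rightarrow> 'a \<Rightarrow> nat \<Rightarrow> 'a" where
  "inner_loop L B lin w 0 = w"
| "inner_loop L B lin w (Suc k) =
    inner_loop L B lin w k - lin *\<^sub>R gradient (\<lambda>v. L v (B k)) (inner_loop L B lin w k)"

(* The gradient is taken in the initialisation v, i.e. through all K inner steps. *)
definition outer_update ::
    "('a::real_inner \<Rightarrow> 'b \<Rightarrow> real) \<Rightarrow> (nat \<Rightarrow> 'b) \<Rightarrow> nat \<Rightarrow> real \<Rightarrow> real \<Rightarrow> 'a \<Rightarrow> 'a" where
  "outer_update L B K lin lo w =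
    w - lo *\<^sub>R gradient (\<lambda>v. L (inner_loop L B lin v K) (B K)) w"

definition loss_change ::
    "('a::real_inner \<Rightarrow> 'b \<Rightarrow> real) \<Rightarrow> (nat \<Rightarrow> 'b) \<Rightarrow> nat \<Rightarrow> real \<Rightarrow> real \<Rightarrow> 'a \<Rightarrow> real" where
  "loss_change L B K lin lo w = L (outer_update L B K lin lo w) (B K) - L w (B K)"

end

theory Submission
  imports Defs
begin

text \<open>Near \<open>w\<close> every loss has a Lipschitz gradient with bounded derivative. Hence each inner step is
  an \<open>O(\<lambda>\<^sub>i\<^sub>n)\<close> perturbation of the identity, in value and in derivative at \<open>w\<close>, and by the chain
  rule the outer gradient is \<open>g\<^sub>K + O(\<lambda>\<^sub>i\<^sub>n)\<close>. The outer step has length \<open>O(\<lambda>\<^sub>o)\<close>, so the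
  quadratic Taylor bound for the query loss costs only \<open>O(\<lambda>\<^sub>o\<^sup>2)\<close>.\<close>

section \<open>Gradients and Hessian bounds near \<open>w\<close>\<close>

text \<open>Riesz representation in coordinates: a linear functional is the inner product with the
  vector of its values on \<open>Basis\<close>.\<close>

lemma has_derivative_imp_GDERIV:
  fixes f :: "'a::euclidean_space \<Rightarrow> real"
  assumes "(f has_derivative f') (at x)"
  shows "GDERIV f x :> (\<Sum>b\<in>Basis. f' b *\<^sub>R b)"
proof -
  interpret bounded_linear f'
    using assms by (rule has_derivative_bounded_linear)
  have "f' h = h \<bullet> (\<Sum>b\<in>Basis. f' b *\<^sub>R b)" for h
  proof -
    have "f' h = f' (\<Sum>b\<in>Basis. (h \<bullet> b) *\<^sub>R b)"
      by (simp add: euclidean_representation)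
    also have "\<dots> = (\<Sum>b\<in>Basis. (h \<bullet> b) * f' b)"
      by (simp add: sum scaleR)
    finally show ?thesis
      by (simp add: inner_sum_right mult.commute)
  qed
  then have "f' = (\<lambda>h. h \<bullet> (\<Sum>b\<in>Basis. f' b *\<^sub>R b))" ..
  with assms show ?thesis
    unfolding gderiv_def by simp
qed

text \<open>Differentiability of \<open>D2\<close> at \<open>w\<close> makes the second derivative
  continuous there, hence bounded on a whole ball. Rewriting \<open>D1\<close> and \<open>D2\<close>
  in coordinates turns this into a bound on the derivative \<open>H\<close> of the gradient.\<close>

lemma three_times_differentiable_at_gradient:
  fixes f :: "'a::euclidean_space \<Rightarrow> real"
  assumes "three_times_differentiable_at f w"
  obtains r C H where "r > 0" "C \<ge> 0"
    "\<And>y. y \<in> ball w r \<Longrightarrow> GDERIV f y :> gradient f y"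
    "\<And>y. y \<in> ball w r \<Longrightarrow> (gradient f has_derivative H y) (at y)"
    "\<And>y h. y \<in> ball w r \<Longrightarrow> norm (H y h) \<le> C * norm h"
proof -
  obtain D1 :: "'a \<Rightarrow> 'a \<Rightarrow>\<^sub>L real" and D2 :: "'a \<Rightarrow> 'a \<Rightarrow>\<^sub>L 'a \<Rightarrow>\<^sub>L real" and D3
    where D1: "\<forall>\<^sub>F y in nhds w. (f has_derivative blinfun_apply (D1 y)) (at y)"
      and D2: "\<forall>\<^sub>F y in nhds w. (D1 has_derivative blinfun_apply (D2 y)) (at y)"
      and D3: "(D2 has_derivative blinfun_apply D3) (at w)"
    using assms unfolding three_times_differentiable_at_def by blast
  have "isCont D2 w"
    using D3 by (rule has_derivative_continuous)
  then have "(D2 \<longlongrightarrow> D2 w) (nhds w)"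
    by (simp add: isCont_def tendsto_at_iff_tendsto_nhds)
  then have "((\<lambda>y. norm (D2 y)) \<longlongrightarrow> norm (D2 w)) (nhds w)"
    by (rule tendsto_norm)
  then have "\<forall>\<^sub>F y in nhds w. norm (D2 y) < norm (D2 w) + 1"
    by (rule order_tendstoD) simp
  with D1 D2 have "\<forall>\<^sub>F y in nhds w. (f has_derivative blinfun_apply (D1 y)) (at y) \<and>
      (D1 has_derivative blinfun_apply (D2 y)) (at y) \<and> norm (D2 y) < norm (D2 w) + 1"
    by eventually_elim simp
  then obtain r where r: "r > 0" and near:
    "\<And>y. dist y w < r \<Longrightarrow> (f has_derivative blinfun_apply (D1 y)) (at y) \<and>
      (D1 has_derivative blinfun_apply (D2 y)) (at y) \<and> norm (D2 y) < norm (D2 w) + 1"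
    unfolding eventually_nhds_metric by blast
  \<comment> \<open>\<open>H y\<close> is the Hessian at \<open>y\<close>, as a linear map on
    vectors. Each of the \<open>DIM('a)\<close> coordinates of \<open>H y h\<close> is at most
    \<open>norm (D2 y) * norm h\<close>, which gives \<open>C\<close>.\<close>
  define H where "H y h = (\<Sum>b\<in>Basis. blinfun_apply (blinfun_apply (D2 y) h) b *\<^sub>R b)" for y h
  define C where "C = real DIM('a) * (norm (D2 w) + 1)"
  have gderiv: "GDERIV f y :> (\<Sum>b\<in>Basis. blinfun_apply (D1 y) b *\<^sub>R b)" if "y \<in> ball w r" for y
    using near[of y] that by (intro has_derivative_imp_GDERIV) (simp add: dist_commute)
  have grad: "gradient f y = (\<Sum>b\<in>Basis. blinfun_apply (D1 y) b *\<^sub>R b)" if "y \<in> ball w r" for y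
    using gderiv[OF that] by (rule gradient_eqI)
  show thesis
  proof
    show "r > 0" by fact
    show "C \<ge> 0" by (simp add: C_def)
    fix y assume y: "y \<in> ball w r"
    show "GDERIV f y :> gradient f y"
      using gderiv[OF y] grad[OF y] by simp
    have D2y: "(D1 has_derivative blinfun_apply (D2 y)) (at y)"
      using near[of y] y by (simp add: dist_commute)
    have "((\<lambda>y. \<Sum>b\<in>Basis. blinfun_apply (D1 y) b *\<^sub>R b) has_derivative H y) (at y)"
      unfolding H_def
      by (intro has_derivative_sum has_derivative_scaleR_left
          bounded_linear.has_derivative[OF blinfun.bounded_linear_left] D2y)
    \<comment> \<open>The coordinate formula for the gradient is known only on the ball; openness is
      enough to transfer the derivative.\<close>
    then show "(gradient f has_derivative H y) (at y)"
      by (rule has_derivative_transform_within_open[OF _ open_ball y]) (simp add: grad)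
    fix h
    have "norm (H y h) \<le> (\<Sum>b\<in>(Basis :: 'a set). norm (D2 y) * norm h)"
      unfolding H_def
    proof (rule sum_norm_le)
      fix b :: 'a assume b: "b \<in> Basis"
      have "\<bar>blinfun_apply (blinfun_apply (D2 y) h) b\<bar> \<le> norm (blinfun_apply (D2 y) h)"
        using norm_blinfun[of "blinfun_apply (D2 y) h" b] b by simp
      also have "\<dots> \<le> norm (D2 y) * norm h"
        by (rule norm_blinfun)
      finally show "norm (blinfun_apply (blinfun_apply (D2 y) h) b *\<^sub>R b) \<le> norm (D2 y) * norm h"
        using b by simp
    qed
    also have "\<dots> = real DIM('a) * norm (D2 y) * norm h"
      by simp
    also have "\<dots> \<le> C * norm h"
      unfolding C_def using near[of y] y
      by (intro mult_right_mono mult_left_mono) (auto simp: dist_commute)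
    finally show "norm (H y h) \<le> C * norm h" .
  qed
qed

text \<open>Mean value inequality on the convex ball. The comparison is with the centre, around
  which all later estimates are made.\<close>

lemma gradient_lipschitz:
  fixes f :: "'a::euclidean_space \<Rightarrow> real"
  assumes "\<And>y. y \<in> ball w r \<Longrightarrow> (gradient f has_derivative H y) (at y)"
    and "\<And>y h. y \<in> ball w r \<Longrightarrow> norm (H y h) \<le> C * norm h"
    and "y \<in> ball w r"
  shows "norm (gradient f y - gradient f w) \<le> C * norm (y - w)"
proof (rule differentiable_bound[of "ball w r"])
  show "(gradient f has_derivative H x) (at x within ball w r)" if "x \<in> ball w r" for x
    using assms(1)[OF that] by (rule has_derivative_at_withinI)
  show "onorm (H x) \<le> C" if "x \<in> ball w r" for x
    by (intro onorm_le assms(2) that)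
  show "w \<in> ball w r"
    using assms(3) by (auto intro: le_less_trans[OF zero_le_dist])
qed (use assms(3) in auto)

text \<open>Subtracting the linear part leaves a function with gradient
  \<open>gradient f x - gradient f w\<close>, which is at most \<open>C * norm (y - w)\<close>
  between \<open>w\<close> and \<open>y\<close>. The mean value inequality supplies the second
  factor \<open>norm (y - w)\<close>.\<close>

lemma gradient_lipschitz_imp_quadratic_bound:
  fixes f :: "'a::euclidean_space \<Rightarrow> real"
  assumes deriv: "\<And>y. y \<in> ball w r \<Longrightarrow> GDERIV f y :> gradient f y"
    and lip: "\<And>y. y \<in> ball w r \<Longrightarrow> norm (gradient f y - gradient f w) \<le> C * norm (y - w)"
    and "C \<ge> 0" and y: "y \<in> ball w r"
  shows "\<bar>f y - f w - (y - w) \<bullet> gradient f w\<bar> \<le> C * (norm (y - w))\<^sup>2"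
proof -
  \<comment> \<open>This ball is convex, contains \<open>w\<close> and \<open>y\<close>, lies inside
    \<open>ball w r\<close>, and bounds \<open>norm (x - w)\<close> uniformly by
    \<open>norm (y - w)\<close>.\<close>
  let ?S = "cball w (norm (y - w))"
  have S: "x \<in> ball w r" and S_norm: "norm (x - w) \<le> norm (y - w)" if "x \<in> ?S" for x
    using that y by (simp_all add: dist_norm norm_minus_commute)
  have "norm ((f y - y \<bullet> gradient f w) - (f w - w \<bullet> gradient f w))
      \<le> (C * norm (y - w)) * norm (y - w)"
  proof (rule differentiable_bound[of ?S])
    fix x assume x: "x \<in> ?S"
    show "((\<lambda>x. f x - x \<bullet> gradient f w) has_derivative
        (\<lambda>h. h \<bullet> gradient f x - h \<bullet> gradient f w)) (at x within ?S)"
      using deriv[OF S[OF x]] unfolding gderiv_def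
      by (rule has_derivative_at_withinI[OF has_derivative_diff])
        (rule has_derivative_inner_left[OF has_derivative_ident])
    show "onorm (\<lambda>h. h \<bullet> gradient f x - h \<bullet> gradient f w) \<le> C * norm (y - w)"
    proof (rule onorm_le)
      fix h
      have "norm (h \<bullet> (gradient f x - gradient f w)) \<le> norm h * norm (gradient f x - gradient f w)"
        by (simp add: Cauchy_Schwarz_ineq2)
      also have "\<dots> \<le> norm h * (C * norm (y - w))"
        using S_norm[OF x] \<open>C \<ge> 0\<close>
        by (intro mult_left_mono order_trans[OF lip[OF S[OF x]]]) simp_all
      finally show "norm (h \<bullet> gradient f x - h \<bullet> gradient f w) \<le> C * norm (y - w) * norm h"
        by (simp add: inner_diff_right mult.commute)
    qed
  qed (simp_all add: dist_norm norm_minus_commute)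
  moreover have "f y - f w - (y - w) \<bullet> gradient f w
      = (f y - y \<bullet> gradient f w) - (f w - w \<bullet> gradient f w)"
    by (simp add: inner_diff_left)
  ultimately show ?thesis
    by (simp add: power2_eq_square mult.assoc)
qed

section \<open>The inner loop as a perturbation of the identity\<close>

text \<open>Induction on the number of steps: each step subtracts \<open>lin\<close> times a map
  that is bounded and has bounded derivative near \<open>w\<close>. The constant may grow with
  \<open>k\<close> but is chosen before \<open>lin\<close>. The derivative is tracked at
  \<open>w\<close> only, which suffices for the chain rule.\<close>

lemma inner_loop_first_order:
  fixes L :: "'a::euclidean_space \<Rightarrow> 'b \<Rightarrow> real"
  assumes "\<And>j. j < k \<Longrightarrow> three_times_differentiable_at (\<lambda>v. L v (B j)) w"
  shows "\<exists>C\<ge>0. \<forall>\<^sub>F lin in at_right 0. norm (inner_loop L B lin w k - w) \<le> C * lin \<and>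
    (\<exists>A. ((\<lambda>v. inner_loop L B lin v k) has_derivative A) (at w) \<and>
      (\<forall>h. norm (A h - h) \<le> C * lin * norm h))"
  using assms
proof (induction k)
  case 0
  have "((\<lambda>v. inner_loop L B lin v 0) has_derivative (\<lambda>h. h)) (at w)" for lin
    by simp
  then show ?case
    by (intro exI[of _ 0]) (auto intro!: always_eventually exI[of _ "\<lambda>h. h"])
next
  case (Suc k)
  then obtain C where "C \<ge> 0" and IH: "\<forall>\<^sub>F lin in at_right 0.
      norm (inner_loop L B lin w k - w) \<le> C * lin \<and>
      (\<exists>A. ((\<lambda>v. inner_loop L B lin v k) has_derivative A) (at w) \<and>
        (\<forall>h. norm (A h - h) \<le> C * lin * norm h))"
    by (auto simp: less_Suc_eq)
  let ?g = "gradient (\<lambda>v. L v (B k))"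
  obtain r M H where r: "r > 0" "M \<ge> 0"
    and H: "\<And>y. y \<in> ball w r \<Longrightarrow> (?g has_derivative H y) (at y)"
      "\<And>y h. y \<in> ball w r \<Longrightarrow> norm (H y h) \<le> M * norm h"
    using three_times_differentiable_at_gradient[OF Suc.prems[OF lessI]] by metis
  have lip: "norm (?g y - ?g w) \<le> M * norm (y - w)" if "y \<in> ball w r" for y
    by (rule gradient_lipschitz[of w r _ H]) (use H that in blast)+
  \<comment> \<open>One constant for both invariants: the first inequality below serves the
    displacement, the second the derivative.\<close>
  define C' where "C' = C + (norm (?g w) + M * r) + M * (1 + C)"
  have C': "C + (norm (?g w) + M * r) \<le> C'" "C + M * (1 + C) \<le> C'"
    using r \<open>C \<ge> 0\<close> by (auto simp: C'_def)
  have "((\<lambda>lin. C * lin) \<longlongrightarrow> C * 0) (at_right 0)"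
    by (intro tendsto_intros)
  \<comment> \<open>This keeps the iterate in the ball where the gradient bounds hold.\<close>
  then have small: "\<forall>\<^sub>F lin in at_right 0. C * lin < r"
    using r by (intro order_tendstoD(2)) auto
  \<comment> \<open>The upper bound \<open>1\<close> makes
    \<open>norm (A h) \<le> (1 + C) * norm h\<close> independent of \<open>lin\<close>.\<close>
  have "\<forall>\<^sub>F lin in at_right (0::real). lin \<in> {0<..<1}"
    by (rule eventually_at_right_real) simp
  with IH small have "\<forall>\<^sub>F lin in at_right 0. norm (inner_loop L B lin w (Suc k) - w) \<le> C' * lin \<and>
    (\<exists>A. ((\<lambda>v. inner_loop L B lin v (Suc k)) has_derivative A) (at w) \<and>
      (\<forall>h. norm (A h - h) \<le> C' * lin * norm h))"
  proof eventually_elim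
    case (elim lin)
    let ?p = "inner_loop L B lin w k"
    have lin: "lin > 0" "lin < 1" and p: "norm (?p - w) \<le> C * lin" "C * lin < r"
      using elim by auto
    then have ball: "?p \<in> ball w r"
      by (simp add: dist_norm norm_minus_commute)
    obtain A where A: "((\<lambda>v. inner_loop L B lin v k) has_derivative A) (at w)"
      and A_id: "\<And>h. norm (A h - h) \<le> C * lin * norm h"
      using elim by blast
    have "norm (?g ?p) \<le> norm (?g w) + norm (?g ?p - ?g w)"
      by (metis add.commute diff_add_cancel norm_triangle_ineq)
    also have "\<dots> \<le> norm (?g w) + M * r"
      using lip[OF ball] p r
      by (intro add_left_mono order_trans[OF lip[OF ball]] mult_left_mono) auto
    finally have g: "norm (?g ?p) \<le> norm (?g w) + M * r" .
    have "norm (inner_loop L B lin w (Suc k) - w) \<le> norm (?p - w) + lin * norm (?g ?p)"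
      using norm_triangle_ineq4[of "?p - w" "lin *\<^sub>R ?g ?p"] lin by (simp add: algebra_simps)
    also have "\<dots> \<le> C * lin + lin * (norm (?g w) + M * r)"
      using p g lin by (intro add_mono mult_left_mono) auto
    also have "\<dots> = (C + (norm (?g w) + M * r)) * lin"
      by (simp add: algebra_simps)
    also have "\<dots> \<le> C' * lin"
      using C' lin by (intro mult_right_mono) auto
    finally have val: "norm (inner_loop L B lin w (Suc k) - w) \<le> C' * lin" .
    \<comment> \<open>Chain rule for the step: \<open>H\<close> is taken at the current iterate
      \<open>?p\<close> and applied after \<open>A\<close>.\<close>
    let ?A = "\<lambda>h. A h - lin *\<^sub>R H ?p (A h)"
    have deriv: "((\<lambda>v. inner_loop L B lin v (Suc k)) has_derivative ?A) (at w)"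
      using A has_derivative_compose[OF A H(1)[OF ball]]
      by (auto intro!: has_derivative_diff has_derivative_scaleR_right)
    have "norm (?A h - h) \<le> C' * lin * norm h" for h
    proof -
      have "norm (A h) \<le> norm h + norm (A h - h)"
        by (metis add.commute diff_add_cancel norm_triangle_ineq)
      also have "\<dots> \<le> norm h + C * lin * norm h"
        using A_id by simp
      also have "\<dots> \<le> norm h + C * 1 * norm h"
        using lin \<open>C \<ge> 0\<close> by (intro add_left_mono mult_right_mono mult_left_mono) auto
      finally have Ah: "norm (A h) \<le> (1 + C) * norm h"
        by (simp add: algebra_simps)
      have "norm (?A h - h) \<le> norm (A h - h) + lin * norm (H ?p (A h))"
        using norm_triangle_ineq4[of "A h - h" "lin *\<^sub>R H ?p (A h)"] lin
        by (simp add: algebra_simps)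
      also have "\<dots> \<le> C * lin * norm h + lin * (M * ((1 + C) * norm h))"
        using lin r
        by (intro add_mono A_id mult_left_mono order_trans[OF H(2)[OF ball]] Ah) auto
      also have "\<dots> = (C + M * (1 + C)) * (lin * norm h)"
        by (simp add: algebra_simps)
      also have "\<dots> \<le> C' * (lin * norm h)"
        using C' lin by (intro mult_right_mono) auto
      finally show ?thesis
        by (simp add: mult.assoc)
    qed
    with val deriv show ?case
      by blast
  qed
  moreover have "C' \<ge> 0"
    using r \<open>C \<ge> 0\<close> by (simp add: C'_def)
  ultimately show ?case
    by blast
qed

section \<open>The gradient through the inner loop\<close>

text \<open>By the chain rule the outer gradient is the adjoint of \<open>A\<close> applied to the
  query gradient at the last iterate. \<open>A\<close> is within O(\<open>lin\<close>) of the
  identity and the iterate within O(\<open>lin\<close>) of \<open>w\<close>.\<close>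

lemma outer_gradient_first_order:
  fixes L :: "'a::euclidean_space \<Rightarrow> 'b \<Rightarrow> real"
  assumes diff: "\<And>k. k \<le> K \<Longrightarrow> three_times_differentiable_at (\<lambda>v. L v (B k)) w"
  shows "\<exists>C\<ge>0. \<forall>\<^sub>F lin in at_right 0.
    norm (gradient (\<lambda>v. L (inner_loop L B lin v K) (B K)) w - gradient (\<lambda>v. L v (B K)) w) \<le> C * lin"
proof -
  let ?f = "\<lambda>v. L v (B K)"
  let ?g = "gradient ?f"
  obtain C where "C \<ge> 0" and loop: "\<forall>\<^sub>F lin in at_right 0.
      norm (inner_loop L B lin w K - w) \<le> C * lin \<and>
      (\<exists>A. ((\<lambda>v. inner_loop L B lin v K) has_derivative A) (at w) \<and>
        (\<forall>h. norm (A h - h) \<le> C * lin * norm h))"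
    using inner_loop_first_order[of K L B w] diff by (auto simp: less_imp_le)
  obtain r M H where r: "r > 0" "M \<ge> 0"
    and f: "\<And>y. y \<in> ball w r \<Longrightarrow> GDERIV ?f y :> ?g y"
    and H: "\<And>y. y \<in> ball w r \<Longrightarrow> (?g has_derivative H y) (at y)"
      "\<And>y h. y \<in> ball w r \<Longrightarrow> norm (H y h) \<le> M * norm h"
    using three_times_differentiable_at_gradient[OF diff[OF order_refl]] by metis
  have lip: "norm (?g y - ?g w) \<le> M * norm (y - w)" if "y \<in> ball w r" for y
    by (rule gradient_lipschitz[of w r _ H]) (use H that in blast)+
  \<comment> \<open>The first summand pays for replacing \<open>A\<close> by the identity, the
    second for moving the query gradient from the last iterate to \<open>w\<close>.\<close>
  define C' where "C' = C * (norm (?g w) + M * r) + M * C"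
  have "((\<lambda>lin. C * lin) \<longlongrightarrow> C * 0) (at_right 0)"
    by (intro tendsto_intros)
  then have small: "\<forall>\<^sub>F lin in at_right 0. C * lin < r"
    using r by (intro order_tendstoD(2)) auto
  have "\<forall>\<^sub>F lin in at_right (0::real). lin > 0"
    by (rule eventually_at_right_less)
  with loop small have "\<forall>\<^sub>F lin in at_right 0.
    norm (gradient (\<lambda>v. L (inner_loop L B lin v K) (B K)) w - ?g w) \<le> C' * lin"
  proof eventually_elim
    case (elim lin)
    let ?p = "inner_loop L B lin w K"
    let ?G = "gradient (\<lambda>v. L (inner_loop L B lin v K) (B K)) w"
    have lin: "lin > 0" and p: "norm (?p - w) \<le> C * lin" "C * lin < r"
      using elim by auto
    then have ball: "?p \<in> ball w r"
      by (simp add: dist_norm norm_minus_commute)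
    obtain A where A: "((\<lambda>v. inner_loop L B lin v K) has_derivative A) (at w)"
      and A_id: "\<And>h. norm (A h - h) \<le> C * lin * norm h"
      using elim by blast
    have F: "((\<lambda>v. L (inner_loop L B lin v K) (B K)) has_derivative (\<lambda>h. A h \<bullet> ?g ?p)) (at w)"
      using has_derivative_compose[OF A f[OF ball, unfolded gderiv_def]] .
    \<comment> \<open>\<open>gradient\<close> is a definite description, so \<open>?G\<close> must
      be certified as a gradient before uniqueness of derivatives yields \<open>AG\<close>.\<close>
    have "GDERIV (\<lambda>v. L (inner_loop L B lin v K) (B K)) w :> ?G"
      using has_derivative_imp_GDERIV[OF F] gradient_eqI[OF has_derivative_imp_GDERIV[OF F]] by simp
    then have "(\<lambda>h. A h \<bullet> ?g ?p) = (\<lambda>h. h \<bullet> ?G)"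
      unfolding gderiv_def by (rule has_derivative_unique[OF F])
    then have AG: "A h \<bullet> ?g ?p = h \<bullet> ?G" for h
      by (rule fun_cong)
    have lip_p: "norm (?g ?p - ?g w) \<le> M * (C * lin)"
      using p r by (intro order_trans[OF lip[OF ball]] mult_left_mono) auto
    have "norm (?g ?p) \<le> norm (?g w) + norm (?g ?p - ?g w)"
      by (metis add.commute diff_add_cancel norm_triangle_ineq)
    also have "\<dots> \<le> norm (?g w) + M * r"
      using lip_p p r by (intro add_left_mono order_trans[OF lip_p] mult_left_mono) auto
    finally have g: "norm (?g ?p) \<le> norm (?g w) + M * r" .
    \<comment> \<open>Testing \<open>AG\<close> with the difference itself avoids forming the
      adjoint of \<open>A\<close>: the squared norm gets a bound linear in \<open>norm ?d\<close>,
      and one factor cancels.\<close>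
    let ?d = "?G - ?g w"
    have "(norm ?d)\<^sup>2 = (A ?d - ?d) \<bullet> ?g ?p + ?d \<bullet> (?g ?p - ?g w)"
      by (simp add: power2_norm_eq_inner inner_diff_left AG inner_diff_right)
    also have "\<dots> \<le> norm (A ?d - ?d) * norm (?g ?p) + norm ?d * norm (?g ?p - ?g w)"
      by (intro add_mono norm_cauchy_schwarz)
    also have "\<dots> \<le> (C * lin * norm ?d) * (norm (?g w) + M * r) + norm ?d * (M * (C * lin))"
      using lin \<open>C \<ge> 0\<close> by (intro add_mono mult_mono A_id g lip_p mult_nonneg_nonneg) auto
    also have "\<dots> = (C' * lin) * norm ?d"
      by (simp add: C'_def algebra_simps)
    finally have "norm ?d * norm ?d \<le> (C' * lin) * norm ?d"
      by (simp add: power2_eq_square)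
    \<comment> \<open>Covers the case \<open>norm ?d = 0\<close>, where no factor can be
      cancelled.\<close>
    moreover have "0 \<le> C' * lin"
      using lin r \<open>C \<ge> 0\<close> by (simp add: C'_def)
    ultimately show ?case
      by (cases "norm ?d = 0") (auto simp: mult_le_cancel_right)
  qed
  moreover have "C' \<ge> 0"
    using r \<open>C \<ge> 0\<close> by (simp add: C'_def)
  ultimately show ?thesis
    by blast
qed

section \<open>Taylor expansion of the query loss along the outer step\<close>

text \<open>The linear Taylor term is \<open>- lo\<close> times the inner product of the outer
  gradient with the query gradient at \<open>w\<close>. Replacing the former by the latter costs
  O(\<open>lin * lo\<close>); the Taylor remainder is O(\<open>lo\<^sup>2\<close>).\<close>

lemma loss_change_first_order:
  fixes L :: "'a::euclidean_space \<Rightarrow> 'b \<Rightarrow> real"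
  assumes diff: "\<And>k. k \<le> K \<Longrightarrow> three_times_differentiable_at (\<lambda>v. L v (B k)) w"
  shows "\<exists>C\<ge>0. \<forall>\<^sub>F (lin, lo) in at_right 0 \<times>\<^sub>F at_right 0.
    \<bar>loss_change L B K lin lo w + lo * (norm (gradient (\<lambda>v. L v (B K)) w))\<^sup>2\<bar>
      \<le> C * (lin * lo + lo\<^sup>2)"
proof -
  let ?f = "\<lambda>v. L v (B K)"
  let ?g = "gradient ?f"
  let ?G = "\<lambda>lin. gradient (\<lambda>v. L (inner_loop L B lin v K) (B K)) w"
  obtain C where "C \<ge> 0" and G: "\<forall>\<^sub>F lin in at_right 0. norm (?G lin - ?g w) \<le> C * lin"
    using outer_gradient_first_order[of K L B w] diff by blast
  obtain r M H where r: "r > 0" "M \<ge> 0"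
    and f: "\<And>y. y \<in> ball w r \<Longrightarrow> GDERIV ?f y :> ?g y"
    and H: "\<And>y. y \<in> ball w r \<Longrightarrow> (?g has_derivative H y) (at y)"
      "\<And>y h. y \<in> ball w r \<Longrightarrow> norm (H y h) \<le> M * norm h"
    using three_times_differentiable_at_gradient[OF diff[OF order_refl]] by metis
  have lip: "norm (?g y - ?g w) \<le> M * norm (y - w)" if "y \<in> ball w r" for y
    by (rule gradient_lipschitz[of w r _ H]) (use H that in blast)+
  have quad: "\<bar>?f y - ?f w - (y - w) \<bullet> ?g w\<bar> \<le> M * (norm (y - w))\<^sup>2" if "y \<in> ball w r" for y
    by (rule gradient_lipschitz_imp_quadratic_bound[of w r]) (use f lip r that in blast)+
  \<comment> \<open>Bounds the outer gradient for all small \<open>lin < 1\<close>, so that the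
    outer step has length at most \<open>lo * N\<close>.\<close>
  define N where "N = norm (?g w) + C"
  have N: "N \<ge> 0"
    using \<open>C \<ge> 0\<close> by (simp add: N_def)
  define C' where "C' = C * norm (?g w) + M * N\<^sup>2"
  have "((\<lambda>lo. lo * N) \<longlongrightarrow> 0 * N) (at_right 0)"
    by (intro tendsto_intros)
  then have "\<forall>\<^sub>F lo in at_right 0. lo * N < r"
    using r by (intro order_tendstoD(2)) auto
  moreover have "\<forall>\<^sub>F lo in at_right (0::real). lo > 0"
    by (rule eventually_at_right_less)
  ultimately have lo: "\<forall>\<^sub>F lo in at_right 0. lo > 0 \<and> lo * N < r"
    by eventually_elim simp
  have "\<forall>\<^sub>F lin in at_right (0::real). lin \<in> {0<..<1}"
    by (rule eventually_at_right_real) simp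
  with G have lin: "\<forall>\<^sub>F lin in at_right 0. lin \<in> {0<..<1} \<and> norm (?G lin - ?g w) \<le> C * lin"
    by eventually_elim simp
  \<comment> \<open>The smallness conditions on \<open>lin\<close> and \<open>lo\<close> are
    separate, as the product filter requires.\<close>
  have "\<bar>loss_change L B K lin lo w + lo * (norm (?g w))\<^sup>2\<bar> \<le> C' * (lin * lo + lo\<^sup>2)"
    if lin: "lin \<in> {0<..<1}" and G: "norm (?G lin - ?g w) \<le> C * lin"
      and lo: "lo > 0" "lo * N < r" for lin lo
  proof -
    let ?y = "outer_update L B K lin lo w"
    have y: "?y - w = - lo *\<^sub>R ?G lin"
      by (simp add: outer_update_def)
    have "norm (?G lin) \<le> norm (?g w) + norm (?G lin - ?g w)"
      by (metis add.commute diff_add_cancel norm_triangle_ineq)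
    also have "\<dots> \<le> norm (?g w) + C * 1"
      using lin \<open>C \<ge> 0\<close> by (intro add_left_mono order_trans[OF G] mult_left_mono) auto
    finally have GN: "norm (?G lin) \<le> N"
      by (simp add: N_def)
    then have yN: "norm (?y - w) \<le> lo * N"
      unfolding y using lo by simp
    then have "?y \<in> ball w r"
      using lo by (simp add: dist_norm norm_minus_commute)
    then have "\<bar>L ?y (B K) - L w (B K) - (?y - w) \<bullet> ?g w\<bar> \<le> M * (norm (?y - w))\<^sup>2"
      by (rule quad)
    also have "\<dots> \<le> M * (lo * N)\<^sup>2"
      using yN r by (intro mult_left_mono power_mono) auto
    finally have taylor:
      "\<bar>loss_change L B K lin lo w + lo * (?G lin \<bullet> ?g w)\<bar> \<le> M * N\<^sup>2 * lo\<^sup>2"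
      by (simp add: loss_change_def y power_mult_distrib mult_ac)
    have "\<bar>(?g w - ?G lin) \<bullet> ?g w\<bar> \<le> norm (?g w - ?G lin) * norm (?g w)"
      by (rule Cauchy_Schwarz_ineq2)
    also have "\<dots> \<le> C * lin * norm (?g w)"
      using G by (intro mult_right_mono) (auto simp: norm_minus_commute)
    finally have "lo * \<bar>(?g w - ?G lin) \<bullet> ?g w\<bar> \<le> lo * (C * lin * norm (?g w))"
      using lo by (intro mult_left_mono) auto
    then have "\<bar>lo * ((?g w - ?G lin) \<bullet> ?g w)\<bar> \<le> C * norm (?g w) * (lin * lo)"
      using lo by (simp add: abs_mult mult_ac)
    moreover have "loss_change L B K lin lo w + lo * (norm (?g w))\<^sup>2
        = (loss_change L B K lin lo w + lo * (?G lin \<bullet> ?g w)) + lo * ((?g w - ?G lin) \<bullet> ?g w)"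
      by (simp add: power2_norm_eq_inner inner_diff_left algebra_simps)
    ultimately have "\<bar>loss_change L B K lin lo w + lo * (norm (?g w))\<^sup>2\<bar>
        \<le> M * N\<^sup>2 * lo\<^sup>2 + C * norm (?g w) * (lin * lo)"
      using taylor by linarith
    also have "\<dots> \<le> C' * lo\<^sup>2 + C' * (lin * lo)"
      using lin lo r \<open>C \<ge> 0\<close> by (intro add_mono mult_right_mono) (auto simp: C'_def)
    finally show ?thesis
      by (simp add: algebra_simps)
  qed
  then have "\<forall>\<^sub>F (lin, lo) in at_right 0 \<times>\<^sub>F at_right 0.
      \<bar>loss_change L B K lin lo w + lo * (norm (?g w))\<^sup>2\<bar> \<le> C' * (lin * lo + lo\<^sup>2)"
    unfolding eventually_prod_filter using lin lo
    by (intro exI[of _ "\<lambda>lin. lin \<in> {0<..<1} \<and> norm (?G lin - ?g w) \<le> C * lin"]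
        exI[of _ "\<lambda>lo. lo > 0 \<and> lo * N < r"]) auto
  moreover have "C' \<ge> 0"
    using r \<open>C \<ge> 0\<close> by (simp add: C'_def)
  ultimately show ?thesis
    by blast
qed

section \<open>Splitting the error into two remainders\<close>

text \<open>The product of the two right-hand filters expresses convergence to (0, 0) through
  positive rates. The remainders are cut out of the exact error, so the identity holds for all
  positive rates and only their size is asymptotic.\<close>

theorem proposition2:
  fixes L :: "real ^ 'd \<Rightarrow> 'b \<Rightarrow> real"
    and B :: "nat \<Rightarrow> 'b"
    and w :: "real ^ 'd"
    and K :: nat
  assumes "K \<ge> 1"
    and "\<And>k. k \<le> K \<Longrightarrow> three_times_differentiable_at (\<lambda>v. L v (B k)) w"
  shows "(\<exists>R1 R2 :: real \<times> real \<Rightarrow> real.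
            R1 \<in> O[at_right 0 \<times>\<^sub>F at_right 0](\<lambda>(lin, lo). lin * lo) \<and>
            R2 \<in> O[at_right 0 \<times>\<^sub>F at_right 0](\<lambda>(lin, lo). lo\<^sup>2) \<and>
            (\<forall>lin>0. \<forall>lo>0.
              loss_change L B K lin lo w =
                - lo * (norm (gradient (\<lambda>v. L v (B K)) w))\<^sup>2 + R1 (lin, lo) + R2 (lin, lo)))
       \<and> (\<forall>lo>0. - lo * (norm (gradient (\<lambda>v. L v (B K)) w))\<^sup>2 \<le> 0)"
proof (intro conjI)
  define g where "g = gradient (\<lambda>v. L v (B K)) w"
  define E where "E = (\<lambda>(lin, lo). loss_change L B K lin lo w + lo * (norm g)\<^sup>2)"
  obtain C where C: "\<forall>\<^sub>F (lin, lo) in at_right 0 \<times>\<^sub>F at_right 0.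
      \<bar>E (lin, lo)\<bar> \<le> C * (lin * lo + lo\<^sup>2)"
    using loss_change_first_order[of K L B w] assms(2) unfolding E_def g_def by auto
  have "\<forall>\<^sub>F x in at_right (0::real) \<times>\<^sub>F at_right (0::real). fst x > 0 \<and> snd x > 0"
    unfolding eventually_prod_filter
    by (intro exI[of _ "\<lambda>x. x > 0"]) (auto simp: eventually_at_right_less)
  with C have bound: "\<forall>\<^sub>F (lin, lo) in at_right 0 \<times>\<^sub>F at_right 0.
      lin > 0 \<and> lo > 0 \<and> \<bar>E (lin, lo)\<bar> \<le> C * (lin * lo + lo\<^sup>2)"
    by eventually_elim auto
  text \<open>The error is split between the two remainders in proportion to their target orders.\<close>
  define R1 where "R1 = (\<lambda>(lin, lo). E (lin, lo) * (lin * lo) / (lin * lo + lo\<^sup>2))"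
  define R2 where "R2 = (\<lambda>(lin, lo). E (lin, lo) * lo\<^sup>2 / (lin * lo + lo\<^sup>2))"
  have pos: "lin * lo + lo\<^sup>2 > 0" if "lin > 0" "lo > 0" for lin lo :: real
    using that by (simp add: add_pos_pos)
  \<comment> \<open>Used with \<open>s = lin * lo + lo\<^sup>2\<close> and \<open>a\<close> one of
    its two summands.\<close>
  have share: "\<bar>e * a / s\<bar> \<le> C * \<bar>a\<bar>" if "\<bar>e\<bar> \<le> C * s" "s > 0" for e a s :: real
    using mult_right_mono[OF that(1), of "\<bar>a\<bar>"] that(2)
    by (simp add: abs_mult pos_divide_le_eq mult_ac)
  have "R1 \<in> O[at_right 0 \<times>\<^sub>F at_right 0](\<lambda>(lin, lo). lin * lo)"
    by (rule bigoI[of _ C], rule eventually_mono[OF bound])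
      (auto simp: R1_def simp flip: real_norm_def intro!: share[unfolded real_norm_def[symmetric]] pos)
  moreover have "R2 \<in> O[at_right 0 \<times>\<^sub>F at_right 0](\<lambda>(lin, lo). lo\<^sup>2)"
    by (rule bigoI[of _ C], rule eventually_mono[OF bound])
      (auto simp: R2_def simp flip: real_norm_def intro!: share[unfolded real_norm_def[symmetric]] pos)
  moreover have "loss_change L B K lin lo w = - lo * (norm g)\<^sup>2 + R1 (lin, lo) + R2 (lin, lo)"
    if "lin > 0" "lo > 0" for lin lo
  proof -
    \<comment> \<open>The two fractions add up to one because the denominator is positive.\<close>
    have "R1 (lin, lo) + R2 (lin, lo) = E (lin, lo)"
      using pos[OF that] by (simp add: R1_def R2_def flip: add_divide_distrib distrib_left)
    then show ?thesis
      by (simp add: E_def)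
  qed
  ultimately show "\<exists>R1 R2 :: real \<times> real \<Rightarrow> real.
      R1 \<in> O[at_right 0 \<times>\<^sub>F at_right 0](\<lambda>(lin, lo). lin * lo) \<and>
      R2 \<in> O[at_right 0 \<times>\<^sub>F at_right 0](\<lambda>(lin, lo). lo\<^sup>2) \<and>
      (\<forall>lin>0. \<forall>lo>0. loss_change L B K lin lo w =
        - lo * (norm (gradient (\<lambda>v. L v (B K)) w))\<^sup>2 + R1 (lin, lo) + R2 (lin, lo))"
    unfolding g_def by blast
qed simp

end
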